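(* Let $0\le\alpha<1$ and let $p\ge q\ge2$ and $n$ be integers with $p+q\le n-2$. Then $\lambda_\alpha(B^1_{n-1,p,q})\ge\lambda_\alpha(B^5_{n,p,q})$.
   Context: All digraphs are simple. For a digraph $G$, $A(G)$ is its adjacency matrix and $D(G)$ the diagonal matrix of outdegrees; $A_\alpha(G)=\alpha D(G)+(1-\alpha)A(G)$ and $\lambda_\alpha(G)$ is the largest modulus of an eigenvalue of $A_\alpha(G)$. $\overleftrightarrow{K_{p,q}}$ is the complete bipartite digraph obtained from $K_{p,q}$ by replacing each edge with a pair of opposite arcs, with parts $V_p=\{v_1,\ldots,v_p\}$ and $V_q=\{v_{p+1},\ldots,v_{p+q}\}$. For $m\ge p+q+1$, with new vertices $v_{p+q+1},\ldots,v_m$: $B^1_{m,p,q}$ is obtained from $\overleftrightarrow{K_{p,q}}$ by adding the directed path $v_1v_{p+q+1}\cdots v_mv_p$, and $B^5_{m,p,q}$ by adding the directed path $v_1v_{p+q+1}\cdots v_mv_{p+1}$. *)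

theory Defs
  imports "Jordan_Normal_Form.Spectral_Radius" "Graph_Theory.Kuratowski"
begin

text \<open>
  The vertices of a digraph, in increasing order, index the rows and columns of its matrices.
\<close>

definition vertex_list :: "'a::linorder pair_pre_digraph \<Rightarrow> 'a list" where
  "vertex_list G = sorted_list_of_set (pverts G)"

definition adjacency_matrix :: "'a::linorder pair_pre_digraph \<Rightarrow> real mat" where
  "adjacency_matrix G =
     mat (card (pverts G)) (card (pverts G))
       (\<lambda>(i, j). if (vertex_list G ! i, vertex_list G ! j) \<in> parcs G then 1 else 0)"

definition outdegree_matrix :: "'a::linorder pair_pre_digraph \<Rightarrow> real mat" where
  "outdegree_matrix G =
     mat_diag (card (pverts G)) (\<lambda>i. real (out_degree (with_proj G) (vertex_list G ! i)))"

definition A_alpha :: "real \<Rightarrow> 'a::linorder pair_pre_digraph \<Rightarrow> real mat" where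
  "A_alpha \<alpha> G = \<alpha> \<cdot>\<^sub>m outdegree_matrix G + (1 - \<alpha>) \<cdot>\<^sub>m adjacency_matrix G"

definition lambda_alpha :: "real \<Rightarrow> 'a::linorder pair_pre_digraph \<Rightarrow> real" where
  "lambda_alpha \<alpha> G = spectral_radius (map_mat complex_of_real (A_alpha \<alpha> G))"

text \<open>
  The vertex \<open>v\<^sub>i\<close> is represented by the number \<open>i \<ge> 1\<close>.
\<close>

definition complete_bip :: "nat \<Rightarrow> nat \<Rightarrow> nat pair_pre_digraph" where
  "complete_bip p q =
     \<lparr>pverts = {1..p + q},
      parcs = {1..p} \<times> {p + 1..p + q} \<union> {p + 1..p + q} \<times> {1..p}\<rparr>"

definition add_path :: "'a pair_pre_digraph \<Rightarrow> 'a list \<Rightarrow> 'a pair_pre_digraph" where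
  "add_path G vs = \<lparr>pverts = pverts G \<union> set vs, parcs = parcs G \<union> set (zip vs (tl vs))\<rparr>"

definition B1 :: "nat \<Rightarrow> nat \<Rightarrow> nat \<Rightarrow> nat pair_pre_digraph" where
  "B1 m p q = add_path (complete_bip p q) (1 # [p + q + 1..<m + 1] @ [p])"

definition B5 :: "nat \<Rightarrow> nat \<Rightarrow> nat \<Rightarrow> nat pair_pre_digraph" where
  "B5 m p q = add_path (complete_bip p q) (1 # [p + q + 1..<m + 1] @ [p + 1])"

lemma complete_bip_complete_bipartite:
  "complete_bipartite_digraph p q (with_proj (complete_bip p q))"
  unfolding complete_bipartite_digraph_pair_def complete_bip_def
  by (simp, intro exI[of _ "{1..p}"] exI[of _ "{p + 1..p + q}"]) auto

lemma add_path_pair_digraph: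
  assumes "pair_digraph G" "distinct_adj vs"
  shows "pair_digraph (add_path G vs)"
proof -
  interpret pair_digraph G by fact
  have "u \<noteq> v" if "(u, v) \<in> set (zip vs (tl vs))" for u v
    using that assms(2) by (induction vs rule: induct_list012) auto
  moreover have in_set_tlD: "v \<in> set vs" if "v \<in> set (tl vs)" for v
    using that by (cases vs) auto
  ultimately show ?thesis
    by unfold_locales
      (auto simp: add_path_def pair_finite_verts pair_finite_arcs wellformed'
        dest: pair_no_loops set_zip_leftD set_zip_rightD in_set_tlD)
qed

lemma complete_bip_pair_digraph: "pair_digraph (complete_bip p q)"
  by unfold_locales (auto simp: complete_bip_def)

lemma distinct_adj_path:
  assumes "a \<le> k" "b \<le> k" "k < m"
  shows "distinct_adj (a # [k + 1..<m + 1] @ [b])"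
  using assms
  by (auto simp: distinct_adj_conv_nth nth_Cons nth_append simp del: upt_Suc split: nat.splits)

lemma B1_pair_digraph: "p + q < m \<Longrightarrow> p > 0 \<Longrightarrow> pair_digraph (B1 m p q)"
  unfolding B1_def
  by (intro add_path_pair_digraph complete_bip_pair_digraph distinct_adj_path) auto

lemma B5_pair_digraph: "p + q < m \<Longrightarrow> p > 0 \<Longrightarrow> q > 0 \<Longrightarrow> pair_digraph (B5 m p q)"
  unfolding B5_def
  by (intro add_path_pair_digraph complete_bip_pair_digraph distinct_adj_path) auto

lemma pverts_B1: "p + q < m \<Longrightarrow> p > 0 \<Longrightarrow> pverts (B1 m p q) = {1..m}"
  by (auto simp: B1_def add_path_def complete_bip_def)

lemma pverts_B5: "p + q < m \<Longrightarrow> q > 0 \<Longrightarrow> pverts (B5 m p q) = {1..m}"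
  by (auto simp: B5_def add_path_def complete_bip_def)

end

theory Submission
  imports Defs
begin

text \<open>
  Normalise a candidate eigenvector to be \<open>1\<close> on \<open>V\<^sub>q\<close>, \<open>x\<close> on \<open>V\<^sub>p - {v\<^sub>1}\<close> and \<open>x1\<close> at \<open>v\<^sub>1\<close>.
  For an eigenvalue \<open>r\<close> the entries along the added path form a geometric progression of ratio
  \<open>t = (1 - \<alpha>) / (r - \<alpha>)\<close>. With \<open>k\<close> inner path vertices in \<open>B\<^sup>1\<close> and \<open>k + 1\<close> in \<open>B\<^sup>5\<close>, the two
  eigenvector equations differ only at \<open>v\<^sub>1\<close>, which sees \<open>t\<^sup>k x\<close> in the first digraph and
  \<open>t\<^sup>k\<^sup>+\<^sup>1\<close> in the second. Since \<open>t \<le> x = (1 - \<alpha>) q / (r - \<alpha> q)\<close>, a positive eigenvector of \<open>B\<^sup>1\<close>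
  for \<open>r\<close> yields a positive vector \<open>z\<close> with \<open>A\<^sub>\<alpha>(B\<^sup>5) z \<le> r z\<close>, so
  \<open>\<lambda>\<^sub>\<alpha>(B\<^sup>5) \<le> r \<le> \<lambda>\<^sub>\<alpha>(B\<^sup>1)\<close>. The number \<open>r\<close> comes from the intermediate value theorem.
\<close>

section \<open>Spectral radius bounds from real test vectors\<close>

text \<open>Collatz-Wielandt argument: for an eigenvector \<open>v\<close> of an eigenvalue
  \<open>ev\<close> of largest modulus, compare moduli in the row \<open>i\<close> maximising
  \<open>cmod (v $ i) / z i\<close>. With \<open>c\<close> this maximum, the moduli are at most
  \<open>c * z\<close> with equality at \<open>i\<close>, so the triangle inequality in row
  \<open>i\<close> gives \<open>norm ev \<le> r\<close>.\<close>

lemma spectral_radius_le_supereigenvector: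
  fixes A :: "real mat"
  assumes A: "A \<in> carrier_mat n n" and n: "n > 0"
    and nonneg: "\<And>i j. i < n \<Longrightarrow> j < n \<Longrightarrow> A $$ (i, j) \<ge> 0"
    and z: "\<And>i. i < n \<Longrightarrow> z i > 0"
    and super: "\<And>i. i < n \<Longrightarrow> (\<Sum>j<n. A $$ (i, j) * z j) \<le> r * z i"
  shows "spectral_radius (map_mat complex_of_real A) \<le> r"
proof -
  let ?C = "map_mat complex_of_real A"
  have C: "?C \<in> carrier_mat n n" using A by simp
  obtain ev where ev: "ev \<in> spectrum ?C" "spectral_radius ?C = norm ev"
    using spectral_radius_mem_max(1)[OF C n] by auto
  then obtain v where v: "v \<in> carrier_vec n" "v \<noteq> 0\<^sub>v n" "?C *\<^sub>v v = ev \<cdot>\<^sub>v v"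
    using A unfolding spectrum_def eigenvalue_def eigenvector_def by auto
  define c where "c = Max ((\<lambda>i. cmod (v $ i) / z i) ` {..<n})"
  have "c \<in> (\<lambda>i. cmod (v $ i) / z i) ` {..<n}"
    unfolding c_def using n by (intro Max_in) auto
  then obtain i where i: "i < n" "c = cmod (v $ i) / z i" by auto
  have le: "cmod (v $ j) \<le> c * z j" if "j < n" for j
  proof -
    have "cmod (v $ j) / z j \<le> c" unfolding c_def using that by (intro Max_ge) auto
    then show ?thesis using z[OF that] by (simp add: divide_le_eq)
  qed
  obtain j where j: "j < n" "v $ j \<noteq> 0"
    using v(1,2) by (metis carrier_vecD eq_vecI index_zero_vec)
  then have "0 < c * z j" using le[OF j(1)] by (meson less_le_trans zero_less_norm_iff)
  then have c: "c > 0" using z[OF j(1)] by (simp add: zero_less_mult_iff)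
  have vi: "cmod (v $ i) = c * z i" using i z[OF i(1)] by simp
  have "ev * v $ i = (?C *\<^sub>v v) $ i" using v i by simp
  also have "\<dots> = (\<Sum>j<n. complex_of_real (A $$ (i, j)) * v $ j)"
    using A v(1) i(1) by (auto simp: scalar_prod_def lessThan_atLeast0 intro!: sum.cong)
  finally have "norm ev * (c * z i) = cmod (\<Sum>j<n. complex_of_real (A $$ (i, j)) * v $ j)"
    using vi by (metis norm_mult)
  also have "\<dots> \<le> (\<Sum>j<n. A $$ (i, j) * (c * z j))"
    using nonneg[OF i(1)] le
    by (intro order.trans[OF norm_sum] sum_mono) (auto simp: norm_mult intro!: mult_left_mono)
  also have "\<dots> = c * (\<Sum>j<n. A $$ (i, j) * z j)"
    by (simp add: sum_distrib_left mult_ac)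
  also have "\<dots> \<le> c * (r * z i)" using super[OF i(1)] c by simp
  finally have "norm ev * (c * z i) \<le> r * (c * z i)" by (simp add: mult_ac)
  then show ?thesis using ev(2) c z[OF i(1)] by simp
qed

lemma spectral_radius_ge_real_eigenvalue:
  fixes A :: "real mat"
  assumes A: "A \<in> carrier_mat n n"
    and z: "\<exists>i<n. z i \<noteq> 0"
    and eigen: "\<And>i. i < n \<Longrightarrow> (\<Sum>j<n. A $$ (i, j) * z j) = r * z i"
  shows "\<bar>r\<bar> \<le> spectral_radius (map_mat complex_of_real A)"
proof -
  let ?C = "map_mat complex_of_real A" and ?v = "vec n (\<lambda>i. complex_of_real (z i))"
  have C: "?C \<in> carrier_mat n n" using A by simp
  have "?v \<noteq> 0\<^sub>v n"
    using z by (metis index_vec index_zero_vec(1) of_real_eq_0_iff)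
  moreover have "?C *\<^sub>v ?v = complex_of_real r \<cdot>\<^sub>v ?v"
  proof (intro eq_vecI)
    fix i assume "i < dim_vec (complex_of_real r \<cdot>\<^sub>v ?v)"
    then have i: "i < n" by simp
    have "(?C *\<^sub>v ?v) $ i = complex_of_real (\<Sum>j<n. A $$ (i, j) * z j)"
      using A i by (auto simp: scalar_prod_def lessThan_atLeast0 intro!: sum.cong)
    then show "(?C *\<^sub>v ?v) $ i = (complex_of_real r \<cdot>\<^sub>v ?v) $ i"
      using eigen[OF i] i by simp
  qed (use A in auto)
  ultimately have "complex_of_real r \<in> spectrum ?C"
    using A unfolding spectrum_def eigenvalue_def eigenvector_def
    by (auto intro!: exI[of _ ?v])
  then have "norm (complex_of_real r) \<in> norm ` spectrum ?C" by blast
  \<comment> \<open>The index in \<open>z\<close> also shows that the dimension is positive, as the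
    maximum over the spectrum requires.\<close>
  then show ?thesis
    using spectral_radius_mem_max(2)[OF C] z by fastforce
qed

section \<open>The matrix as an operator on vertex functions\<close>

text \<open>The action of \<open>A_alpha\<close> freed from the numbering of the vertices, so that
  eigenvector equations can be checked vertex by vertex.\<close>

definition alpha_operator ::
    "real \<Rightarrow> 'a pair_pre_digraph \<Rightarrow> ('a \<Rightarrow> real) \<Rightarrow> 'a \<Rightarrow> real" where
  "alpha_operator \<alpha> G f v =
     \<alpha> * real (card {w. (v, w) \<in> parcs G}) * f v + (1 - \<alpha>) * (\<Sum>w | (v, w) \<in> parcs G. f w)"

lemma out_degree_with_proj: "out_degree (with_proj G) v = card {w. (v, w) \<in> parcs G}"
proof -
  have "out_arcs (with_proj G) v = Pair v ` {w. (v, w) \<in> parcs G}" by auto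
  then show ?thesis unfolding out_degree_def by (simp add: card_image inj_on_def)
qed

lemma A_alpha_carrier: "A_alpha \<alpha> G \<in> carrier_mat (card (pverts G)) (card (pverts G))"
  by (simp add: A_alpha_def adjacency_matrix_def outdegree_matrix_def)

context
  fixes G :: "'a::linorder pair_pre_digraph"
  assumes fin_digraph: "pair_fin_digraph G"
begin

interpretation pair_fin_digraph G by (fact fin_digraph)

lemma bij_betw_vertex_list:
  "bij_betw ((!) (vertex_list G)) {..<card (pverts G)} (pverts G)"
  unfolding vertex_list_def
  by (rule bij_betw_nth) (simp_all add: pair_finite_verts)

lemma A_alpha_row_sum:
  assumes i: "i < card (pverts G)"
  shows "(\<Sum>j<card (pverts G). A_alpha \<alpha> G $$ (i, j) * f (vertex_list G ! j))
    = alpha_operator \<alpha> G f (vertex_list G ! i)"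
proof -
  let ?n = "card (pverts G)" and ?l = "vertex_list G"
  let ?d = "real (card {w. (?l ! i, w) \<in> parcs G})"
  have "(\<Sum>j<?n. A_alpha \<alpha> G $$ (i, j) * f (?l ! j))
      = (\<Sum>j<?n. (if i = j then \<alpha> * ?d * f (?l ! j) else 0)
          + (1 - \<alpha>) * (if (?l ! i, ?l ! j) \<in> parcs G then f (?l ! j) else 0))"
    using i by (intro sum.cong)
      (auto simp: A_alpha_def adjacency_matrix_def outdegree_matrix_def mat_diag_def
        out_degree_with_proj algebra_simps)
  also have "\<dots> = \<alpha> * ?d * f (?l ! i)
      + (1 - \<alpha>) * (\<Sum>j<?n. if (?l ! i, ?l ! j) \<in> parcs G then f (?l ! j) else 0)"
    using i by (simp add: sum.distrib sum_distrib_left)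
  also have "(\<Sum>j<?n. if (?l ! i, ?l ! j) \<in> parcs G then f (?l ! j) else 0)
      = (\<Sum>w\<in>pverts G. if (?l ! i, w) \<in> parcs G then f w else 0)"
    by (rule sum.reindex_bij_betw[OF bij_betw_vertex_list])
  \<comment> \<open>Heads of arcs are vertices, so the filter on \<open>pverts G\<close> loses no
    out-neighbour.\<close>
  also have "\<dots> = (\<Sum>w | (?l ! i, w) \<in> parcs G. f w)"
    using in_arcsD2 by (subst sum.inter_filter[symmetric])
      (auto simp: pair_finite_verts intro!: sum.cong)
  finally show ?thesis by (simp add: alpha_operator_def)
qed

text \<open>For \<alpha> between 0 and 1 all entries of \<open>A_alpha\<close> are nonnegative, so
  the supereigenvector bound applies.\<close>

lemma lambda_alpha_le:
  assumes "0 \<le> \<alpha>" "\<alpha> \<le> 1" "pverts G \<noteq> {}"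
    and pos: "\<And>v. v \<in> pverts G \<Longrightarrow> f v > 0"
    and super: "\<And>v. v \<in> pverts G \<Longrightarrow> alpha_operator \<alpha> G f v \<le> r * f v"
  shows "lambda_alpha \<alpha> G \<le> r"
  unfolding lambda_alpha_def
proof (rule spectral_radius_le_supereigenvector[OF A_alpha_carrier])
  show "0 < card (pverts G)" using assms(3) by (simp add: card_gt_0_iff pair_finite_verts)
  have vert: "vertex_list G ! i \<in> pverts G" if "i < card (pverts G)" for i
    using bij_betwE[OF bij_betw_vertex_list] that by simp
  show "f (vertex_list G ! i) > 0" if "i < card (pverts G)" for i
    by (rule pos[OF vert[OF that]])
  show "(\<Sum>j<card (pverts G). A_alpha \<alpha> G $$ (i, j) * f (vertex_list G ! j))
      \<le> r * f (vertex_list G ! i)" if "i < card (pverts G)" for i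
    unfolding A_alpha_row_sum[OF that] by (rule super[OF vert[OF that]])
qed (use assms(1,2) in
      \<open>auto simp: A_alpha_def adjacency_matrix_def outdegree_matrix_def mat_diag_def\<close>)

lemma lambda_alpha_ge:
  assumes "v \<in> pverts G" "f v \<noteq> 0"
    and eigen: "\<And>v. v \<in> pverts G \<Longrightarrow> alpha_operator \<alpha> G f v = r * f v"
  shows "\<bar>r\<bar> \<le> lambda_alpha \<alpha> G"
  unfolding lambda_alpha_def
proof (rule spectral_radius_ge_real_eigenvalue[OF A_alpha_carrier])
  show "\<exists>i<card (pverts G). f (vertex_list G ! i) \<noteq> 0"
    using assms(1,2) bij_betw_imp_surj_on[OF bij_betw_vertex_list]
    by (metis (no_types, lifting) imageE lessThan_iff)
  have vert: "vertex_list G ! i \<in> pverts G" if "i < card (pverts G)" for i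
    using bij_betwE[OF bij_betw_vertex_list] that by simp
  show "(\<Sum>j<card (pverts G). A_alpha \<alpha> G $$ (i, j) * f (vertex_list G ! j))
      = r * f (vertex_list G ! i)" if "i < card (pverts G)" for i
    unfolding A_alpha_row_sum[OF that] by (rule eigen[OF vert[OF that]])
qed

end

section \<open>Arcs of a complete bipartite digraph with an added path\<close>

text \<open>\<open>add_path\<close> takes its arcs from consecutive list entries. Peeling off
  \<open>a\<close> removes one arc and leaves \<open>(m, e)\<close> for the base case.\<close>

lemma set_zip_tl_upt:
  assumes "a \<le> m"
  shows "set (zip ([a..<Suc m] @ [e]) (tl ([a..<Suc m] @ [e])))
    = {(i, Suc i) | i. a \<le> i \<and> i < m} \<union> {(m, e)}"
  using assms
proof (induction "m - a" arbitrary: a)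
  case 0
  then show ?case by auto
next
  case (Suc d)
  have "[a..<Suc m] = a # [Suc a..<Suc m]" "[Suc a..<Suc m] = Suc a # [Suc (Suc a)..<Suc m]"
    using Suc.hyps(2) by (simp_all add: upt_conv_Cons del: upt_Suc)
  then have "set (zip ([a..<Suc m] @ [e]) (tl ([a..<Suc m] @ [e])))
      = insert (a, Suc a) (set (zip ([Suc a..<Suc m] @ [e]) (tl ([Suc a..<Suc m] @ [e]))))"
    by simp
  also have "\<dots> = insert (a, Suc a) ({(i, Suc i) | i. Suc a \<le> i \<and> i < m} \<union> {(m, e)})"
    using Suc.hyps by (subst Suc.hyps(1)) auto
  also have "\<dots> = {(i, Suc i) | i. a \<le> i \<and> i < m} \<union> {(m, e)}"
    using Suc.hyps(2) by (auto simp: Suc_le_eq le_neq_implies_less)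
  finally show ?case .
qed

text \<open>Covers \<open>B1\<close> with \<open>e = p\<close> and \<open>B5\<close> with
  \<open>e = p + 1\<close>, so that both are computed at once.\<close>

definition bip_path :: "nat \<Rightarrow> nat \<Rightarrow> nat \<Rightarrow> nat \<Rightarrow> nat pair_pre_digraph" where
  "bip_path m p q e = add_path (complete_bip p q) (1 # [p + q + 1..<m + 1] @ [e])"

lemma parcs_bip_path:
  assumes "p + q < m"
  shows "parcs (bip_path m p q e) =
    {1..p} \<times> {p + 1..p + q} \<union> {p + 1..p + q} \<times> {1..p} \<union> {(1, p + q + 1)}
    \<union> {(i, Suc i) | i. p + q < i \<and> i < m} \<union> {(m, e)}"
proof -
  let ?u = "[p + q + 1..<m + 1]"
  have "?u = (p + q + 1) # [p + q + 2..<m + 1]"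
    using assms by (simp add: upt_conv_Cons del: upt_Suc)
  then have "set (zip (1 # ?u @ [e]) (tl (1 # ?u @ [e])))
      = insert (1, p + q + 1) (set (zip (?u @ [e]) (tl (?u @ [e]))))"
    by simp
  also have "\<dots> = insert (1, p + q + 1) ({(i, Suc i) | i. p + q < i \<and> i < m} \<union> {(m, e)})"
    using set_zip_tl_upt[of "p + q + 1" m e] assms by (simp add: Suc_le_eq del: upt_Suc)
  finally show ?thesis
    unfolding bip_path_def add_path_def complete_bip_def by auto
qed

lemma out_neighbours_bip_path:
  assumes "p + q < m" "0 < p"
  shows "{w. (1, w) \<in> parcs (bip_path m p q e)} = insert (p + q + 1) {p + 1..p + q}"
    and "1 < v \<Longrightarrow> v \<le> p \<Longrightarrow> {w. (v, w) \<in> parcs (bip_path m p q e)} = {p + 1..p + q}"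
    and "p < v \<Longrightarrow> v \<le> p + q \<Longrightarrow> {w. (v, w) \<in> parcs (bip_path m p q e)} = {1..p}"
    and "p + q < v \<Longrightarrow> v < m \<Longrightarrow> {w. (v, w) \<in> parcs (bip_path m p q e)} = {Suc v}"
    and "{w. (m, w) \<in> parcs (bip_path m p q e)} = {e}"
  using assms by (auto simp: parcs_bip_path)

section \<open>Vectors that are geometric along the path\<close>

text \<open>In the next definition \<open>s\<close> is meant to be the value at the end vertex of the added path.\<close>

definition bip_path_vector ::
    "nat \<Rightarrow> nat \<Rightarrow> nat \<Rightarrow> real \<Rightarrow> real \<Rightarrow> real \<Rightarrow> real \<Rightarrow> nat \<Rightarrow> real" where
  "bip_path_vector m p q x1 x s t v =
     (if v = 1 then x1 else if v \<le> p then x else if v \<le> p + q then 1 else s * t ^ (m + 1 - v))"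

text \<open>The exponent \<open>m + 1 - v\<close> counts the arcs from \<open>v\<close> to the end
  vertex \<open>e\<close>. The assumption on \<open>e\<close> extends the progression to exponent 0,
  so the last path vertex obeys the same formula as the others.\<close>

lemma alpha_operator_bip_path:
  fixes \<alpha> x1 x t :: real
  assumes m: "p + q < m" and p: "0 < p"
    and e: "bip_path_vector m p q x1 x s t e = s"
  defines "f \<equiv> bip_path_vector m p q x1 x s t"
  shows "alpha_operator \<alpha> (bip_path m p q e) f 1
      = \<alpha> * (real q + 1) * x1 + (1 - \<alpha>) * (real q + s * t ^ (m - (p + q)))"
    and "1 < v \<Longrightarrow> v \<le> p \<Longrightarrow>
      alpha_operator \<alpha> (bip_path m p q e) f v = \<alpha> * real q * x + (1 - \<alpha>) * real q"
    and "p < v \<Longrightarrow> v \<le> p + q \<Longrightarrow>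
      alpha_operator \<alpha> (bip_path m p q e) f v = \<alpha> * real p + (1 - \<alpha>) * (x1 + (real p - 1) * x)"
    and "p + q < v \<Longrightarrow> v \<le> m \<Longrightarrow>
      alpha_operator \<alpha> (bip_path m p q e) f v
        = \<alpha> * (s * t ^ (m + 1 - v)) + (1 - \<alpha>) * (s * t ^ (m - v))"
proof -
  note nb = out_neighbours_bip_path[OF m p]
  have Vq: "(\<Sum>w\<in>{p + 1..p + q}. f w) = q"
  proof -
    have "(\<Sum>w\<in>{p + 1..p + q}. f w) = (\<Sum>w\<in>{p + 1..p + q}. 1)"
      using p by (intro sum.cong) (auto simp: f_def bip_path_vector_def)
    then show ?thesis by simp
  qed
  have Vp: "(\<Sum>w\<in>{1..p}. f w) = x1 + (real p - 1) * x"
  proof -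
    have "(\<Sum>w\<in>{1..p}. f w) = f 1 + (\<Sum>w\<in>{2..p}. f w)"
      using p by (simp add: sum.atLeast_Suc_atMost numeral_2_eq_2)
    also have "(\<Sum>w\<in>{2..p}. f w) = (\<Sum>w\<in>{2..p}. x)"
      by (intro sum.cong) (auto simp: f_def bip_path_vector_def)
    finally show ?thesis using p by (simp add: f_def bip_path_vector_def)
  qed
  have "f (p + q + 1) = s * t ^ (m - (p + q))"
    using p by (simp add: f_def bip_path_vector_def)
  then show "alpha_operator \<alpha> (bip_path m p q e) f 1
      = \<alpha> * (real q + 1) * x1 + (1 - \<alpha>) * (real q + s * t ^ (m - (p + q)))"
    using Vq unfolding alpha_operator_def nb(1)
    by (simp add: f_def bip_path_vector_def add_ac)
  show "alpha_operator \<alpha> (bip_path m p q e) f v = \<alpha> * real q * x + (1 - \<alpha>) * real q"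
    if "1 < v" "v \<le> p"
    using that Vq unfolding alpha_operator_def nb(2)[OF that]
    by (simp add: f_def bip_path_vector_def)
  show "alpha_operator \<alpha> (bip_path m p q e) f v = \<alpha> * real p + (1 - \<alpha>) * (x1 + (real p - 1) * x)"
    if "p < v" "v \<le> p + q"
    using that p Vp unfolding alpha_operator_def nb(3)[OF that]
    by (simp add: f_def bip_path_vector_def)
  show "alpha_operator \<alpha> (bip_path m p q e) f v
        = \<alpha> * (s * t ^ (m + 1 - v)) + (1 - \<alpha>) * (s * t ^ (m - v))"
    if v: "p + q < v" "v \<le> m"
  proof (cases "v = m")
    case True
    then show ?thesis
      using p v e unfolding alpha_operator_def True nb(5)
      by (simp add: f_def bip_path_vector_def)
  next
    case False
    then have "v < m" using v by simp
    then show ?thesis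
      using p v unfolding alpha_operator_def nb(4)[OF v(1) \<open>v < m\<close>]
      by (simp add: f_def bip_path_vector_def)
  qed
qed

section \<open>Existence of the common number \<open>r\<close>\<close>

text \<open>
  The last equation of the conclusion, cleared of denominators, is polynomial in \<open>r\<close>; the
  polynomial is negative at \<open>max (\<alpha> p) (\<alpha> (q + 1))\<close> and nonnegative at \<open>p + q + 1\<close>.
\<close>

lemma quotient_eigenvalue_exists:
  fixes \<alpha> :: real and p q k :: nat
  assumes \<alpha>: "0 \<le> \<alpha>" "\<alpha> < 1" and pq: "1 \<le> q" "1 \<le> p"
  obtains r x x1 t :: real where "\<alpha> * real p < r" "\<alpha> * (real q + 1) < r"
    "t = (1 - \<alpha>) / (r - \<alpha>)" "x = (1 - \<alpha>) * real q / (r - \<alpha> * real q)"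
    "x1 = (1 - \<alpha>) * (real q + t ^ k * x) / (r - \<alpha> * (real q + 1))"
    "r - \<alpha> * real p = (1 - \<alpha>) * (x1 + (real p - 1) * x)"
proof -
  define \<beta> where "\<beta> = 1 - \<alpha>"
  have \<beta>: "\<beta> > 0" using \<alpha> by (simp add: \<beta>_def)
  \<comment> \<open>The equations on the path, on \<open>V_p - {v_1}\<close> and at
    \<open>v_1\<close> are solved for the entries as functions of \<open>r\<close>;
    \<open>G r = 0\<close> is the one left over, on \<open>V_q\<close>.\<close>
  define T X X1 :: "real \<Rightarrow> real"
    where "T r = \<beta> / (r - \<alpha>)" and "X r = \<beta> * q / (r - \<alpha> * real q)"
    and "X1 r = \<beta> * (q + T r ^ k * X r) / (r - \<alpha> * (real q + 1))" for r :: real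
  define G where "G r = r - \<alpha> * real p - \<beta> * (X1 r + (real p - 1) * X r)" for r :: real
  \<comment> \<open>\<open>P\<close> collects the denominators of \<open>G\<close>, and
    \<open>H\<close> is \<open>P * G\<close> expanded, hence defined and continuous also where
    \<open>G\<close> has a pole.\<close>
  define P where "P r = (r - \<alpha> * real q) * (r - \<alpha> * (real q + 1)) * (r - \<alpha>) ^ k" for r :: real
  define H where "H r = (r - \<alpha> * real p) * P r
    - \<beta>\<^sup>2 * (q * (r - \<alpha> * real q) * (r - \<alpha>) ^ k + \<beta> ^ Suc k * q
    + (real p - 1) * q * (r - \<alpha> * (real q + 1)) * (r - \<alpha>) ^ k)" for r :: real
  define c where "c = max (\<alpha> * real p) (\<alpha> * (real q + 1))"
  define M where "M = real p + q + 1"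
  have aq: "\<alpha> * real q \<le> \<alpha> * (real q + 1)" "\<alpha> \<le> \<alpha> * (real q + 1)"
    using \<alpha> by (auto simp: algebra_simps)
  have HG: "H r = P r * G r" if "\<alpha> * (real q + 1) < r" for r
  proof -
    have "r - \<alpha> * real q \<noteq> 0" "r - \<alpha> * (real q + 1) \<noteq> 0" "r - \<alpha> \<noteq> 0" using that aq by linarith+
    then show ?thesis
      unfolding H_def P_def G_def X1_def X_def T_def
      by (simp add: divide_simps power2_eq_square power_divide) (simp add: algebra_simps)
  qed
  have "H c < 0"
  proof -
    \<comment> \<open>At \<open>c\<close> a factor of the leading product vanishes. The subtracted
      term \<open>\<beta> ^ Suc k * q\<close> keeps the sign strict even for \<alpha> = 0, where
      \<open>c = 0\<close>.\<close>
    have c: "c - \<alpha> * real q \<ge> 0" "c - \<alpha> * (real q + 1) \<ge> 0" "c - \<alpha> \<ge> 0"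
      using aq unfolding c_def by linarith+
    have "(c - \<alpha> * real p) * P c = 0" unfolding P_def c_def by (auto simp: max_def)
    moreover have "0 < \<beta> ^ Suc k * q" using \<beta> pq by simp
    moreover have "0 \<le> q * (c - \<alpha> * real q) * (c - \<alpha>) ^ k"
      "0 \<le> (real p - 1) * q * (c - \<alpha> * (real q + 1)) * (c - \<alpha>) ^ k"
      using c pq by (auto intro!: mult_nonneg_nonneg)
    ultimately show ?thesis unfolding H_def using \<beta>
      by (smt (verit) mult_pos_pos zero_less_power)
  qed
  have bound: "\<alpha> * d \<le> d" if "d \<ge> 0" for d :: real
    using \<alpha> that by (simp add: mult_left_le_one_le)
  have cM: "c < M" "\<alpha> * (real q + 1) < M"
    using bound[of "real p"] bound[of "real q + 1"] pq unfolding c_def M_def by linarith+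
  \<comment> \<open>As \<open>\<beta> = 1 - \<alpha>\<close>, this amounts to
    \<open>d \<le> M\<close>. It is used for \<open>d\<close> equal to 1, \<open>q\<close> and
    \<open>q + 1\<close>, and bounds every entry at \<open>M\<close> by 1.\<close>
  have quot: "\<beta> * d / (M - \<alpha> * d) \<le> 1" if "0 \<le> d" "d < M" for d
    using bound[of d] that by (simp add: divide_le_eq \<beta>_def algebra_simps)
  have "0 \<le> G M"
  proof -
    have T: "T M \<le> 1" "0 \<le> T M" using quot[of 1] \<alpha> \<beta> pq by (auto simp: T_def M_def)
    have X: "X M \<le> 1" "0 \<le> X M"
      using quot[of "real q"] bound[of "real q"] \<beta> by (auto simp: X_def M_def)
    have "T M ^ k * X M \<le> 1" using T X by (intro mult_le_one power_le_one) auto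
    then have "X1 M \<le> \<beta> * (real q + 1) / (M - \<alpha> * (real q + 1))"
      unfolding X1_def using \<beta> cM by (intro divide_right_mono mult_left_mono) auto
    also have "\<dots> \<le> 1" using quot[of "real q + 1"] pq by (simp add: M_def)
    finally have "X1 M + (real p - 1) * X M \<le> 1 + (real p - 1) * 1"
      using X pq by (intro add_mono mult_left_mono) auto
    then have "\<beta> * (X1 M + (real p - 1) * X M) \<le> \<beta> * p" using \<beta> by simp
    then show ?thesis unfolding G_def M_def \<beta>_def by (simp add: algebra_simps)
  qed
  moreover have "0 < P M" using cM aq unfolding P_def by (intro mult_pos_pos zero_less_power) auto
  ultimately have "0 \<le> H M" using HG[OF cM(2)] by simp
  moreover have "continuous_on {c..M} H"
    unfolding H_def P_def by (intro continuous_intros)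
  ultimately obtain r where r: "c \<le> r" "r \<le> M" "H r = 0"
    using IVT'[of H c 0 M] \<open>H c < 0\<close> cM(1) by auto
  \<comment> \<open>Strictness makes \<open>P r\<close> positive, so the root of \<open>H\<close> is
    a root of \<open>G\<close>.\<close>
  with \<open>H c < 0\<close> have "c < r" by (cases "c = r") auto
  then have gt: "\<alpha> * real p < r" "\<alpha> * (real q + 1) < r" unfolding c_def by auto
  then have "P r > 0" using aq unfolding P_def by (intro mult_pos_pos zero_less_power) auto
  then have "G r = 0" using HG[OF gt(2)] r(3) by simp
  then show thesis
    using that[OF gt T_def[of r, unfolded \<beta>_def] X_def[of r, unfolded \<beta>_def]
        X1_def[of r, unfolded \<beta>_def]]
    unfolding G_def \<beta>_def by simp
qed

section \<open>Comparison of the two digraphs\<close>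

theorem theorem4p8:
  fixes \<alpha> :: real and n p q :: nat
  assumes "0 \<le> \<alpha>" and "\<alpha> < 1"
    and "2 \<le> q" and "q \<le> p" and "p + q + 2 \<le> n"
  shows "lambda_alpha \<alpha> (B1 (n - 1) p q) \<ge> lambda_alpha \<alpha> (B5 n p q)"
proof -
  define m k where "m = n - 1" and "k = m - (p + q)"
  have m: "p + q < m" "p + q < n" "n = Suc m" using assms by (auto simp: m_def)
  have k: "m - (p + q) = k" "n - (p + q) = Suc k" using m by (auto simp: k_def)
  obtain r x x1 t :: real where r: "\<alpha> * real p < r" "\<alpha> * (real q + 1) < r"
    and t: "t = (1 - \<alpha>) / (r - \<alpha>)" and x: "x = (1 - \<alpha>) * real q / (r - \<alpha> * real q)"
    and x1: "x1 = (1 - \<alpha>) * (real q + t ^ k * x) / (r - \<alpha> * (real q + 1))"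
    and y: "r - \<alpha> * real p = (1 - \<alpha>) * (x1 + (real p - 1) * x)"
    by (rule quotient_eigenvalue_exists[of \<alpha> q p k]) (use assms in auto)
  have "\<alpha> * real q \<le> \<alpha> * (real q + 1)" "\<alpha> \<le> \<alpha> * (real q + 1)"
    using assms(1) by (auto simp: algebra_simps)
  then have r': "r - \<alpha> * real q > 0" "r - \<alpha> > 0" "r - \<alpha> * (real q + 1) > 0" using r by linarith+
  have pos: "t > 0" "x > 0" using r' assms by (auto simp: t x)
  then have "x1 > 0" using r' assms unfolding x1
    by (intro divide_pos_pos mult_pos_pos add_pos_pos zero_less_power) auto
  note pos = pos this
  \<comment> \<open>Cleared of denominators this is \<open>r \<le> r * q\<close>, true since
    \<open>r \<ge> 0\<close> and \<open>q \<ge> 1\<close>.\<close>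
  have "t \<le> x"
  proof -
    have "0 \<le> r" using r' assms by linarith
    then have "r * 1 \<le> r * q" using assms by (intro mult_left_mono) auto
    then have "r - \<alpha> * real q \<le> q * (r - \<alpha>)" by (simp add: algebra_simps)
    then have "1 / (r - \<alpha>) \<le> q / (r - \<alpha> * real q)" using r' by (simp add: field_simps)
    then have "(1 - \<alpha>) * (1 / (r - \<alpha>)) \<le> (1 - \<alpha>) * (real q / (r - \<alpha> * real q))"
      using assms by (intro mult_left_mono) auto
    then show ?thesis by (simp add: t x)
  qed
  have eq_x: "\<alpha> * real q * x + (1 - \<alpha>) * real q = r * x"
    using r' by (simp add: x field_simps)
  have eq_x1: "\<alpha> * (real q + 1) * x1 + (1 - \<alpha>) * (real q + t ^ k * x) = r * x1"
  proof -
    have "(r - \<alpha> * (real q + 1)) * x1 = (1 - \<alpha>) * (real q + t ^ k * x)"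
      using r' unfolding x1 by simp
    then show ?thesis by (simp add: algebra_simps)
  qed
  have eq_y: "\<alpha> * real p + (1 - \<alpha>) * (x1 + (real p - 1) * x) = r" using y by simp
  \<comment> \<open>Because \<open>1 - \<alpha> = (r - \<alpha>) * t\<close>, this holds for any end
    value \<open>s\<close> and length, and serves both digraphs.\<close>
  have eq_path: "\<alpha> * (s * t ^ (M + 1 - v)) + (1 - \<alpha>) * (s * t ^ (M - v))
      = r * (s * t ^ (M + 1 - v))"
    if "v \<le> M" for s M v
  proof -
    have "M + 1 - v = Suc (M - v)" using that by simp
    moreover have "(1 - \<alpha>) * (s * t ^ (M - v)) = (r - \<alpha>) * t * (s * t ^ (M - v))"
      using r' by (simp add: t)
    ultimately show ?thesis by (simp add: algebra_simps)
  qed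
  have "lambda_alpha \<alpha> (B5 n p q) \<le> r"
  proof -
    interpret pair_digraph "B5 n p q" using m assms by (intro B5_pair_digraph) auto
    \<comment> \<open>The path ends in \<open>V_q\<close>, where the value is 1; hence
      \<open>s = 1\<close>.\<close>
    define f where "f = bip_path_vector n p q x1 x 1 t"
    have B5: "B5 n p q = bip_path n p q (p + 1)" by (simp add: B5_def bip_path_def)
    have verts: "pverts (B5 n p q) = {1..n}" using m assms by (intro pverts_B5) auto
    have "bip_path_vector n p q x1 x 1 t (p + 1) = 1"
      using assms by (simp add: bip_path_vector_def)
    note op = alpha_operator_bip_path[OF m(2) _ this, where \<alpha> = \<alpha>, folded f_def B5]
    show ?thesis
    proof (rule lambda_alpha_le[OF pair_fin_digraph_axioms, where f = f])
      show "f v > 0" for v using pos by (simp add: f_def bip_path_vector_def)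
      show "alpha_operator \<alpha> (B5 n p q) f v \<le> r * f v" if v: "v \<in> pverts (B5 n p q)" for v
      proof -
        consider "v = 1" | "1 < v" "v \<le> p" | "p < v" "v \<le> p + q" | "p + q < v" "v \<le> n"
          using v verts by fastforce
        then show ?thesis
        proof cases
          case 1
          \<comment> \<open>The only vertex where equality may fail.\<close>
          have "t ^ Suc k \<le> t ^ k * x" using \<open>t \<le> x\<close> pos by (simp add: mult.commute)
          then have "(1 - \<alpha>) * (real q + t ^ Suc k) \<le> (1 - \<alpha>) * (real q + t ^ k * x)"
            using assms by (intro mult_left_mono) auto
          moreover have "alpha_operator \<alpha> (B5 n p q) f 1
              = \<alpha> * (real q + 1) * x1 + (1 - \<alpha>) * (real q + t ^ Suc k)"
            using op(1) assms k by simp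
          ultimately have "alpha_operator \<alpha> (B5 n p q) f 1 \<le> r * x1"
            using eq_x1 by linarith
          then show ?thesis using 1 by (simp add: f_def bip_path_vector_def)
        next
          case 2
          then show ?thesis using op(2)[OF _ 2] eq_x by (simp add: f_def bip_path_vector_def)
        next
          case 3
          then show ?thesis
            using op(3)[OF _ 3] eq_y assms by (simp add: f_def bip_path_vector_def)
        next
          case 4
          then show ?thesis
            using op(4)[OF _ 4] eq_path[of v n 1] assms by (simp add: f_def bip_path_vector_def)
        qed
      qed
    qed (use assms verts in auto)
  qed
  also have "r \<le> lambda_alpha \<alpha> (B1 m p q)"
  proof -
    interpret pair_digraph "B1 m p q" using m assms by (intro B1_pair_digraph) auto
    define f where "f = bip_path_vector m p q x1 x x t"
    have B1: "B1 m p q = bip_path m p q p" by (simp add: B1_def bip_path_def)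
    have verts: "pverts (B1 m p q) = {1..m}" using m assms by (intro pverts_B1) auto
    \<comment> \<open>Since \<open>p \<ge> 2\<close>, the end vertex \<open>p\<close> is not
      \<open>v_1\<close> and carries \<open>x\<close> rather than \<open>x1\<close>.\<close>
    have "bip_path_vector m p q x1 x x t p = x"
      using assms by (simp add: bip_path_vector_def)
    note op = alpha_operator_bip_path[OF m(1) _ this, where \<alpha> = \<alpha>, folded f_def B1]
    have "\<bar>r\<bar> \<le> lambda_alpha \<alpha> (B1 m p q)"
    proof (rule lambda_alpha_ge[OF pair_fin_digraph_axioms, where f = f and v = 1])
      show "f 1 \<noteq> 0" using pos by (simp add: f_def bip_path_vector_def)
      show "alpha_operator \<alpha> (B1 m p q) f v = r * f v" if v: "v \<in> pverts (B1 m p q)" for v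
      proof -
        consider "v = 1" | "1 < v" "v \<le> p" | "p < v" "v \<le> p + q" | "p + q < v" "v \<le> m"
          using v verts by fastforce
        then show ?thesis
        proof cases
          case 1
          then show ?thesis
            using op(1) eq_x1 assms k by (simp add: f_def bip_path_vector_def mult.commute)
        next
          case 2
          then show ?thesis using op(2)[OF _ 2] eq_x by (simp add: f_def bip_path_vector_def)
        next
          case 3
          then show ?thesis
            using op(3)[OF _ 3] eq_y assms by (simp add: f_def bip_path_vector_def)
        next
          case 4
          then show ?thesis
            using op(4)[OF _ 4] eq_path[of v m x] assms by (simp add: f_def bip_path_vector_def)
        qed
      qed
    qed (use m verts in auto)
    then show ?thesis by simp
  qed
  finally show ?thesis by (simp add: m_def)
qed

end
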